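(* Let $\mathbb{A}=\{1,4,6,9,\ldots\}$ be the set of positive integers congruent to $1$ or $4$ modulo $5$, let $\mathbb{B}=\{2,3,7,8,\ldots\}$ be the set of positive integers congruent to $2$ or $3$ modulo $5$, and let $M\ge1$, $n\ge 1$, $k\ge 0$ be integers. (a) Suppose that $\lambda$ is a partition of $M$ into parts from $\mathbb{A}$. Then $E_{\lambda}^{\mathbb{A}}(n,k)$ is equal to the number of partitions $\nu=(\nu_1\ge\nu_2\ge\cdots)$ of $n$ with difference at least $2$ satisfying: (1) if $\nu$ has exactly one part, then $\lfloor n/M\rfloor=k$; (2) if $\nu$ has at least two parts, then $\lfloor(\nu_1-\nu_2-2)/M\rfloor=k$. (b) Suppose that $\lambda$ is a partition of $M$ into parts from $\mathbb{B}$. Then $E_{\lambda}^{\mathbb{B}}(n,k)$ is equal to the number of partitions $\nu=(\nu_1\ge\nu_2\ge\cdots)$ of $n$ with difference at least $2$, with no part equal to $1$, satisfying: (1) if $\nu$ has exactly one part, then $n=Mk+j$ for some integer $j$ with $2\le j\le M-1$, or $j=0$, or $j=M+1$; (2) if $\nu$ has at least two parts, then $\lfloor(\nu_1-\nu_2-2)/M\rfloor=k$.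
   Context: A partition $\nu=(\nu_1\ge\nu_2\ge\cdots\ge\nu_\ell\ge 1)$ has "difference at least $2$" if $\nu_i-\nu_{i+1}\ge 2$ for all $1\le i<\ell$ (a one-part partition satisfies this vacuously). For a partition $\lambda=(A_1^{m_1},\ldots,A_t^{m_t})$ (distinct part sizes $A_s$ with multiplicities $m_s\ge1$) and a partition $\mu$, let $$E_\lambda(\mu)=\max\{j\ge 0:\ \mu \text{ contains at least } jm_s \text{ parts of size } A_s \text{ for all } s\}.$$ For a set $\mathbb{S}$ of positive integers and a partition $\lambda$ with parts from $\mathbb{S}$, $E_\lambda^{\mathbb{S}}(n,k)$ is the number of partitions $\mu$ of $n$ with parts from $\mathbb{S}$ such that $E_\lambda(\mu)=k$. *)

theory Defs
  imports Main
begin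

text \<open>
  A partition is the weakly decreasing list of its parts; the part written \<open>\<nu>\<^sub>i\<close> (counting
  from 1) is the list element \<open>\<nu> ! (i - 1)\<close>.
\<close>

definition is_partition :: "nat \<Rightarrow> nat list \<Rightarrow> bool" where
  "is_partition n \<nu> \<longleftrightarrow> sorted_wrt (\<ge>) \<nu> \<and> (\<forall>a\<in>set \<nu>. 1 \<le> a) \<and> sum_list \<nu> = n"

definition partitions_into :: "nat set \<Rightarrow> nat \<Rightarrow> nat list set" where
  "partitions_into S n = {\<mu>. is_partition n \<mu> \<and> set \<mu> \<subseteq> S}"

definition difference_ge2 :: "nat list \<Rightarrow> bool" where
  "difference_ge2 \<nu> \<longleftrightarrow> (\<forall>i. Suc i < length \<nu> \<longrightarrow> int (\<nu> ! i) - int (\<nu> ! Suc i) \<ge> 2)"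

text \<open>
  The maximum below is only meaningful for \<open>lam\<close> nonempty, since otherwise every \<open>j\<close> is admissible.
\<close>

definition E_parts :: "nat list \<Rightarrow> nat list \<Rightarrow> nat" where
  "E_parts lam \<mu> = Max {j. \<forall>a\<in>set lam. j * count_list lam a \<le> count_list \<mu> a}"

definition E_count :: "nat set \<Rightarrow> nat list \<Rightarrow> nat \<Rightarrow> nat \<Rightarrow> nat" where
  "E_count S lam n k = card {\<mu> \<in> partitions_into S n. E_parts lam \<mu> = k}"

definition set_A :: "nat set" where
  "set_A = {a. 0 < a \<and> (a mod 5 = 1 \<or> a mod 5 = 4)}"

definition set_B :: "nat set" where
  "set_B = {a. 0 < a \<and> (a mod 5 = 2 \<or> a mod 5 = 3)}"

lemma finite_is_partition: "finite {\<nu>. is_partition n \<nu>}"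
proof (rule finite_subset)
  have "length \<nu> \<le> sum_list \<nu>" if "\<forall>a\<in>set \<nu>. 1 \<le> a" for \<nu> :: "nat list"
    using that by (induction \<nu>) auto
  then show "{\<nu>. is_partition n \<nu>} \<subseteq> {\<nu>. set \<nu> \<subseteq> {..n} \<and> length \<nu> \<le> n}"
    by (auto simp: is_partition_def intro: member_le_sum_list)
  show "finite {\<nu>. set \<nu> \<subseteq> {..n} \<and> length \<nu> \<le> n}"
    by (rule finite_lists_length_le) simp
qed

lemma finite_E_parts:
  assumes "lam \<noteq> []"
  shows "finite {j. \<forall>a\<in>set lam. j * count_list lam a \<le> count_list \<mu> a}"
proof (rule finite_subset)
  have a: "hd lam \<in> set lam" using assms by simp
  then have "1 \<le> count_list lam (hd lam)" using count_list_0_iff by fastforce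
  then have "j \<le> j * count_list lam (hd lam)" for j by simp
  with a show "{j. \<forall>a\<in>set lam. j * count_list lam a \<le> count_list \<mu> a}
      \<subseteq> {..count_list \<mu> (hd lam)}"
    using le_trans by blast
qed simp

end

theory Submission
  imports Defs "HOL-Computational_Algebra.Formal_Power_Series" "HOL-Library.Multiset"
begin

text \<open>
  Both sides are differences of consecutive values of one function of k. Removing k copies of
  \<open>lam\<close> shows that the partitions of n into parts from a set S with \<open>E_parts lam \<mu> \<ge> k\<close> are as many as all
  partitions of \<open>n - k * M\<close> into parts from S (lemma \<open>card_contains_copies\<close>). Subtracting d from the
  largest part shows that the partitions of n with difference at least 2 whose two largest parts
  satisfy \<open>\<nu>\<^sub>1 - \<nu>\<^sub>2 - 2 \<ge> d\<close> are as many as the partitions of \<open>n - d\<close> with difference at least 2 and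
  at least two parts (lemma \<open>gap_ge_shift\<close>); for \<open>d = k * M\<close> the inequality says that the floor in
  the theorem is at least k. For \<open>set_B\<close> the part 1 is excluded throughout. So the claim follows once,
  for every m, the partitions of m into parts from S are equinumerous with those with difference at
  least 2, and the conditions on the one-part partition account exactly for the partitions with at
  most one part, which have no second part to form a gap with (lemma \<open>E_count_eq_card\<close>).
  
  The equinumerosity is the pair of Rogers--Ramanujan identities (theorem \<open>rogers_ramanujan\<close>), proved here
  along the lines of Schur and Andrews. The generating polynomials \<open>D N\<close> of the partitions with difference at
  least 2 and all parts below N satisfy \<open>D (N + 2) = D (N + 1) + q ^ (N + 1) * D N\<close>, since a largest part N + 1 forces
  the others below N. An alternating sum of Gaussian binomial coefficients satisfies the same
  recurrence (lemma \<open>schur_rec\<close>). As N grows, each Gaussian coefficient tends to the inverse of the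
  product of all \<open>1 - q ^ i\<close>, so that D tends to this inverse times a theta series. By a finite form of
  Jacobi's triple product (lemma \<open>jacobi_finite\<close>) the theta series is the product of \<open>1 - q ^ i\<close> over
  the residue classes modulo 5 complementary to those of S; what remains in the denominator are
  exactly the factors with i in S. All limits are taken as congruences modulo
  powers of the formal variable.
\<close>

section \<open>Gaussian binomial coefficients\<close>

definition qpoch :: "'a::comm_ring_1 \<Rightarrow> nat \<Rightarrow> 'a" where
  "qpoch q n = (\<Prod>i=1..n. 1 - q ^ i)"

text \<open>
  The lower index is an integer, with value 0 outside 0, ..., n. The sums over all integers j that
  occur below can then be shifted freely, and both Pascal rules hold for every index.
\<close>

fun qbin :: "'a::comm_ring_1 \<Rightarrow> nat \<Rightarrow> int \<Rightarrow> 'a" where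
  "qbin q 0 k = of_bool (k = 0)"
| "qbin q (Suc n) k = qbin q n (k - 1) + q ^ nat k * qbin q n k"

lemma qpoch_0 [simp]: "qpoch q 0 = 1"
  by (simp add: qpoch_def)

lemma qpoch_Suc [simp]: "qpoch q (Suc n) = qpoch q n * (1 - q ^ Suc n)"
  by (simp add: qpoch_def)

lemma qbin_eq_0: "k < 0 \<or> k > int n \<Longrightarrow> qbin q n k = 0"
  by (induction n arbitrary: k) auto

lemma qbin_0_right [simp]: "qbin q n 0 = 1"
  by (induction n) (simp_all add: qbin_eq_0)

lemma qbin_self [simp]: "qbin q n (int n) = 1"
  by (induction n) (simp_all add: qbin_eq_0)

text \<open>
  The second Pascal rule, which is the first one seen through the symmetry of the coefficients
  under k \<mapsto> n - k. Both finite identities below come from combining the two rules.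
\<close>

lemma qbin_Suc_alt:
  "qbin q (Suc n) k = q ^ nat (int n + 1 - k) * qbin q n (k - 1) + qbin q n k"
proof (induction n arbitrary: k)
  case 0
  then show ?case by auto
next
  case (Suc n)
  \<comment> \<open>Both products are \<open>q ^ (n + 1)\<close> where the coefficient is nonzero; elsewhere truncation by
    \<open>nat\<close> makes the exponents meaningless, but the coefficient vanishes.\<close>
  have mid: "q ^ nat k * q ^ nat (int n + 1 - k) * qbin q n (k - 1) =
      q ^ nat (int n + 2 - k) * q ^ nat (k - 1) * qbin q n (k - 1)"
  proof (cases "1 \<le> k \<and> k \<le> int n + 1")
    case True
    then have "nat k + nat (int n + 1 - k) = nat (int n + 2 - k) + nat (k - 1)" by linarith
    then show ?thesis by (simp flip: power_add)
  next
    case False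
    then show ?thesis by (auto simp: qbin_eq_0)
  qed
  have "qbin q (Suc (Suc n)) k = qbin q (Suc n) (k - 1) + q ^ nat k * qbin q (Suc n) k"
    by simp
  also have "\<dots> = q ^ nat (int n + 2 - k) * qbin q n (k - 2) + qbin q n (k - 1)
      + (q ^ nat k * q ^ nat (int n + 1 - k) * qbin q n (k - 1) + q ^ nat k * qbin q n k)"
    unfolding Suc.IH[of "k - 1"] Suc.IH[of k] by (simp add: algebra_simps)
  also have "\<dots> = q ^ nat (int n + 2 - k) * qbin q (Suc n) (k - 1) + qbin q (Suc n) k"
    unfolding mid by (simp add: algebra_simps)
  finally show ?case by (simp add: algebra_simps del: qbin.simps)
qed

lemma qbin_mult_qpoch:
  assumes "b \<le> n"
  shows "qbin q n (int b) * (qpoch q b * qpoch q (n - b)) = qpoch q n"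
  using assms
proof (induction n arbitrary: b)
  case 0
  then show ?case by simp
next
  case (Suc n)
  consider "b = 0" | "b = Suc n" | c where "b = Suc c" "b \<le> n"
    using Suc.prems by (cases b) (auto simp: le_Suc_eq)
  then show ?case
  proof cases
    case 1
    then show ?thesis by (simp del: qbin.simps)
  next
    case 2
    then show ?thesis using qbin_self[of q "Suc n"] by (simp del: qbin.simps qbin_self)
  next
    case 3
    have d: "Suc n - b = Suc (n - b)" "n - c = Suc (n - b)" using 3 by auto
    have 1: "qbin q n (int c) * (qpoch q c * qpoch q (n - c)) = qpoch q n"
      using Suc.IH[of c] 3 by simp
    have 2: "qbin q n (int b) * (qpoch q b * qpoch q (n - b)) = qpoch q n"
      using Suc.IH[of b] 3 by simp
    have "qbin q (Suc n) (int b) = qbin q n (int c) + q ^ b * qbin q n (int b)"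
      unfolding qbin.simps nat_int using 3(1) by simp
    then have "qbin q (Suc n) (int b) * (qpoch q b * qpoch q (Suc n - b)) =
      (1 - q ^ b) * (qbin q n (int c) * (qpoch q c * qpoch q (n - c)))
      + q ^ b * (1 - q ^ (Suc (n - b))) * (qbin q n (int b) * (qpoch q b * qpoch q (n - b)))"
      unfolding d by (simp add: 3 algebra_simps)
    also have "\<dots> = qpoch q n * (1 - q ^ b * q ^ Suc (n - b))"
      unfolding 1 2 by (simp add: algebra_simps)
    also have "q ^ b * q ^ Suc (n - b) = q ^ Suc n"
      using 3 by (simp flip: power_add power_Suc)
    finally show ?thesis by simp
  qed
qed

section \<open>Theta terms\<close>

text \<open>
  The sum of \<open>theta q c j\<close> over all j is the theta series that both sides of a Rogers--Ramanujan
  identity become when multiplied by the product of all \<open>1 - q ^ i\<close>.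
  The parameter c is 0 for the identity of the residues 1, 4 and 1 for that of the residues 2, 3,
  so that the two identities get a single proof.
\<close>

definition theta_exp :: "nat \<Rightarrow> int \<Rightarrow> int" where
  "theta_exp c j = (5 * j\<^sup>2 + (1 - 4 * int c) * j) div 2"

definition theta :: "'a::comm_ring_1 \<Rightarrow> nat \<Rightarrow> int \<Rightarrow> 'a" where
  "theta q c j = (if even j then 1 else -1) * q ^ nat (theta_exp c j)"

lemma two_theta_exp: "2 * theta_exp c j = 5 * j\<^sup>2 + (1 - 4 * int c) * j"
  unfolding theta_exp_def by (rule dvd_mult_div_cancel) simp

text \<open>
  The growth of the exponents: modulo a power of q, only finitely many theta terms survive.
\<close>

lemma theta_exp_ge: "c \<le> 1 \<Longrightarrow> \<bar>j\<bar> \<le> theta_exp c j"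
proof -
  assume c: "c \<le> 1"
  have "\<bar>j\<bar> \<le> j\<^sup>2"
    by (metis power2_abs abs_ge_zero self_le_power abs_0 order_le_less int_one_le_iff_zero_less
        zero_less_numeral zero_power2)
  moreover have "c = 0 \<or> c = 1" using c by auto
  ultimately show ?thesis using two_theta_exp[of c j] by (auto simp: abs_if split: if_splits)
qed

lemma theta_exp_nonneg: "c \<le> 1 \<Longrightarrow> 0 \<le> theta_exp c j"
  using theta_exp_ge[of c j] by simp

lemma theta_exp_plus1: "theta_exp c (j + 1) = theta_exp c j + 5 * j + 3 - 2 * int c"
  using two_theta_exp[of c j] two_theta_exp[of c "j + 1"] by (simp add: power2_eq_square algebra_simps)

text \<open>
  Passing from j to j + 1 changes the sign and adds 5j + 3 - 2c to the exponent. The two finite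
  identities use no other relation between theta terms.
\<close>

lemma theta_shift:
  assumes "c \<le> 1" "a \<ge> 0" "b \<ge> 0" "a + 5 * j + 3 = 2 * int c + b"
  shows "theta q c (j + 1) * q ^ nat a = - (theta q c j * q ^ nat b)"
proof -
  have "nat (theta_exp c (j + 1)) + nat a = nat (theta_exp c j) + nat b"
    using assms theta_exp_nonneg[of c j] theta_exp_nonneg[of c "j + 1"] theta_exp_plus1[of c j] by linarith
  then have "q ^ nat (theta_exp c (j + 1)) * q ^ nat a = q ^ nat (theta_exp c j) * q ^ nat b"
    by (simp flip: power_add)
  then show ?thesis by (simp add: theta_def)
qed

lemma sum_telescope_int:
  fixes h :: "int \<Rightarrow> 'a::comm_ring_1"
  shows "(\<Sum>j=- int R..int R. h j - h (j + 1)) = h (- int R) - h (int R + 1)"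
proof (induction R)
  case 0
  then show ?case by simp
next
  case (Suc R)
  have "{- int (Suc R)..int (Suc R)} = insert (- int (Suc R)) (insert (int (Suc R)) {- int R..int R})"
    by auto
  then show ?case by (simp add: Suc algebra_simps)
qed

lemma half_bounds:
  fixes x :: int
  shows "2 * (x div 2) \<le> x" "x \<le> 2 * (x div 2) + 1"
  by linarith+

lemma half_less: "x < 2 * a \<Longrightarrow> x div 2 < (a :: int)"
  by linarith

section \<open>Schur's polynomials\<close>

text \<open>
  Schur's alternating sum. Only finitely many j contribute; R is a cut-off beyond the
  support, so that the sum is over one and the same interval for all n up to R.
\<close>

definition schur :: "'a::comm_ring_1 \<Rightarrow> nat \<Rightarrow> nat \<Rightarrow> nat \<Rightarrow> 'a" where
  "schur q c R n = (\<Sum>j=- int R..int R. theta q c j * qbin q n ((int n - 5 * j) div 2 + int c))"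

text \<open>
  Why Schur's sum satisfies the recurrence of the partitions with difference at least 2: applying
  one Pascal rule to \<open>D (n + 2) - D (n + 1)\<close> and the other to the result splits off
  \<open>q ^ (n + 1) * D n\<close> term by term. What remains is carried by the terms h j: for j of the parity
  of n the remainder is h j, for the other parity it is -h (j + 1). As h vanishes off
  the parity of n, the remainder is h j - h (j + 1) throughout and telescopes.
\<close>

lemma schur_term:
  fixes q :: "'a::comm_ring_1" and n :: nat and j :: int
  assumes c: "c \<le> 1"
  defines "h \<equiv> (\<lambda>j. if even (int n - j) then theta q c j * (q ^ nat ((int n + 2 - 5 * j) div 2 + int c)
                * qbin q n ((int n + 2 - 5 * j) div 2 + int c)) else 0)"
  shows "theta q c j * (qbin q (n + 2) ((int (n + 2) - 5 * j) div 2 + int c)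
      - qbin q (n + 1) ((int (n + 1) - 5 * j) div 2 + int c)
      - q ^ (n + 1) * qbin q n ((int n - 5 * j) div 2 + int c)) = h j - h (j + 1)"
proof (cases "even (int n - j)")
  case True
  define m where "m = (int n + 2 - 5 * j) div 2 + int c"
  have ix: "(int (n + 2) - 5 * j) div 2 + int c = m" "(int (n + 1) - 5 * j) div 2 + int c = m - 1"
     "(int n - 5 * j) div 2 + int c = m - 1"
    unfolding m_def using True by presburger+
  have e: "q ^ nat m * (q ^ nat (int n + 1 - m) * qbin q n (m - 1)) = q ^ (n + 1) * qbin q n (m - 1)"
  proof (cases "1 \<le> m \<and> m \<le> int n + 1")
    case True
    then have "nat m + nat (int n + 1 - m) = n + 1" by linarith
    then show ?thesis by (metis mult.assoc power_add)
  next
    case False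
    then show ?thesis by (auto simp: qbin_eq_0)
  qed
  have "qbin q (n + 2) m - qbin q (n + 1) (m - 1) = q ^ nat m * qbin q (Suc n) m"
    by simp
  also have "\<dots> = q ^ (n + 1) * qbin q n (m - 1) + q ^ nat m * qbin q n m"
    unfolding qbin_Suc_alt e[symmetric] by (simp add: algebra_simps)
  finally have "qbin q (n + 2) m - qbin q (n + 1) (m - 1) - q ^ (n + 1) * qbin q n (m - 1)
      = q ^ nat m * qbin q n m" by simp
  moreover have "h j = theta q c j * (q ^ nat m * qbin q n m)" "h (j + 1) = 0"
    using True by (simp_all add: h_def m_def)
  ultimately show ?thesis unfolding ix by simp
next
  case False
  define m where "m = (int n + 2 - 5 * j) div 2 + int c"
  have ix: "(int (n + 2) - 5 * j) div 2 + int c = m" "(int (n + 1) - 5 * j) div 2 + int c = m"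
     "(int n - 5 * j) div 2 + int c = m - 1" "(int n + 2 - 5 * (j + 1)) div 2 + int c = m - 2"
    and m2: "2 * m = int n + 1 - 5 * j + 2 * int c"
    unfolding m_def using False by presburger+
  have e: "q ^ nat (int n + 2 - m) * (q ^ nat (m - 1) * qbin q n (m - 1)) = q ^ (n + 1) * qbin q n (m - 1)"
  proof (cases "1 \<le> m \<and> m \<le> int n + 1")
    case True
    then have "nat (int n + 2 - m) + nat (m - 1) = n + 1" by linarith
    then show ?thesis by (metis mult.assoc power_add)
  next
    case False
    then show ?thesis by (auto simp: qbin_eq_0)
  qed
  have "qbin q (n + 2) m - qbin q (n + 1) m = q ^ nat (int n + 2 - m) * qbin q (n + 1) (m - 1)"
    using qbin_Suc_alt[of q "Suc n" m] by (simp del: qbin.simps add: algebra_simps)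
  also have "\<dots> = q ^ nat (int n + 2 - m) * qbin q n (m - 2) + q ^ (n + 1) * qbin q n (m - 1)"
    unfolding e[symmetric] by (simp add: algebra_simps)
  finally have *: "qbin q (n + 2) m - qbin q (n + 1) m - q ^ (n + 1) * qbin q n (m - 1)
      = q ^ nat (int n + 2 - m) * qbin q n (m - 2)" by simp
  have "theta q c (j + 1) * q ^ nat (m - 2) * qbin q n (m - 2) =
      - (theta q c j * q ^ nat (int n + 2 - m)) * qbin q n (m - 2)"
  proof (cases "2 \<le> m \<and> m \<le> int n + 2")
    case True
    then show ?thesis
      using m2 by (subst theta_shift[OF c, of "m - 2" "int n + 2 - m"]) auto
  next
    case False
    then show ?thesis by (auto simp: qbin_eq_0)
  qed
  moreover have "h j = 0" using False by (simp add: h_def)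
  moreover have "even (int n - (j + 1))" using False by presburger
  then have "h (j + 1) = theta q c (j + 1) * (q ^ nat (m - 2) * qbin q n (m - 2))"
    unfolding h_def ix by (simp only: if_True)
  ultimately show ?thesis unfolding ix * by (simp add: mult.assoc)
qed

lemma schur_rec:
  assumes c: "c \<le> 1" and R: "n + 2 \<le> R"
  shows "schur q c R (n + 2) = schur q c R (n + 1) + q ^ (n + 1) * schur q c R n"
proof -
  define h where "h = (\<lambda>j. if even (int n - j) then theta q c j * (q ^ nat ((int n + 2 - 5 * j) div 2 + int c)
                * qbin q n ((int n + 2 - 5 * j) div 2 + int c)) else 0)"
  have "schur q c R (n + 2) - schur q c R (n + 1) - q ^ (n + 1) * schur q c R n
      = (\<Sum>j=- int R..int R. h j - h (j + 1))"
    unfolding schur_def sum_distrib_left sum_subtractf[symmetric]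
    by (rule sum.cong[OF refl], unfold h_def schur_term[OF c, symmetric])
       (simp add: algebra_simps del: qbin.simps)
  also have "\<dots> = h (- int R) - h (int R + 1)" by (rule sum_telescope_int)
  also have "\<dots> = 0"
  proof -
    have a: "(int n + 2 - 5 * (- int R)) div 2 + int c > int n"
      using R c half_bounds[of "int n + 2 - 5 * (- int R)"] by linarith
    have "int n + 2 \<le> int R" "int c \<le> 1" "0 \<le> int n" using R c by auto
    then have "int n + 2 - 5 * (int R + 1) < 2 * (- int c)" by presburger
    then have "(int n + 2 - 5 * (int R + 1)) div 2 < - int c" by (rule half_less)
    then have b: "(int n + 2 - 5 * (int R + 1)) div 2 + int c < 0" by linarith
    have "h (- int R) = 0" unfolding h_def qbin_eq_0[OF disjI2[OF a]] by simp
    moreover have "h (int R + 1) = 0" unfolding h_def qbin_eq_0[OF disjI1[OF b]] by simp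
    ultimately show ?thesis by simp
  qed
  finally show ?thesis by (simp add: algebra_simps)
qed

lemma schur_single_term:
  assumes "\<And>j. j \<noteq> 0 \<Longrightarrow> qbin q n ((int n - 5 * j) div 2 + int c) = 0"
  shows "schur q c R n = qbin q n (int n div 2 + int c)"
proof -
  have "schur q c R n = (\<Sum>j\<in>{0}. theta q c j * qbin q n ((int n - 5 * j) div 2 + int c))"
    unfolding schur_def by (rule sum.mono_neutral_right) (use assms in auto)
  then show ?thesis by (simp add: theta_def theta_exp_def)
qed

lemma schur_init:
  "schur q 0 R 0 = 1" "schur q 0 R 1 = 1" "schur q 1 R 1 = 1" "schur q 1 R 2 = 1"
proof -
  have z: "(int n - 5 * j) div 2 + int c < 0 \<or> (int n - 5 * j) div 2 + int c > int n"
    if "c \<le> n" "n \<le> Suc c" "c \<le> 1" "j \<noteq> 0" for n c :: nat and j :: int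
    using that half_bounds[of "int n - 5 * j"] by linarith
  have "schur q c R n = qbin q n (int n div 2 + int c)"
    if "c \<le> n" "n \<le> Suc c" "c \<le> 1" for n c :: nat
    by (rule schur_single_term) (use z[OF that] in \<open>auto intro!: qbin_eq_0\<close>)
  from this[of 0 0] this[of 0 1] this[of 1 1] this[of 1 2]
  show "schur q 0 R 0 = 1" "schur q 0 R 1 = 1" "schur q 1 R 1 = 1" "schur q 1 R 2 = 1"
    using qbin_self[of q 1] qbin_self[of q 2] by (simp_all add: qbin_0_right del: qbin.simps)
qed

section \<open>A finite form of Jacobi's triple product\<close>

definition triple_prod :: "'a::comm_ring_1 \<Rightarrow> nat \<Rightarrow> nat \<Rightarrow> 'a" where
  "triple_prod q c N = (\<Prod>i<N. (1 - q ^ (5 * i + 3 - 2 * c)) * (1 - q ^ (5 * i + 2 + 2 * c)))"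

text \<open>
  Two steps in the upper index, taken symmetrically about the middle coefficient. The coefficients
  \<open>1 + q ^ (2 * N + 1)\<close> and the two powers of q are those of the pair of factors
  \<open>(1 - z * q ^ N) * (1 - q ^ (N + 1) / z)\<close> that the triple product gains from N to N + 1.
\<close>

lemma qbin_add2:
  "qbin q (2 * N + 2) (int N + 1 + j) = (1 + q ^ (2 * N + 1)) * qbin q (2 * N) (int N + j)
     + q ^ nat (int N + 1 - j) * qbin q (2 * N) (int N + j - 1)
     + q ^ nat (int N + 1 + j) * qbin q (2 * N) (int N + j + 1)"
proof -
  have e: "q ^ nat (int N + 1 + j) * (q ^ nat (int N - j) * qbin q (2 * N) (int N + j)) =
     q ^ (2 * N + 1) * qbin q (2 * N) (int N + j)"
  proof (cases "0 \<le> int N + j \<and> int N + j \<le> 2 * int N")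
    case True
    then have "nat (int N + 1 + j) + nat (int N - j) = 2 * N + 1" by linarith
    then show ?thesis by (metis mult.assoc power_add)
  next
    case False
    then show ?thesis by (auto simp: qbin_eq_0)
  qed
  have "qbin q (2 * N + 2) (int N + 1 + j) =
      qbin q (Suc (2 * N)) (int N + j) + q ^ nat (int N + 1 + j) * qbin q (Suc (2 * N)) (int N + j + 1)"
    by (simp add: algebra_simps)
  also have "\<dots> = q ^ nat (int N + 1 - j) * qbin q (2 * N) (int N + j - 1) + qbin q (2 * N) (int N + j)
     + (q ^ nat (int N + 1 + j) * (q ^ nat (int N - j) * qbin q (2 * N) (int N + j))
         + q ^ nat (int N + 1 + j) * qbin q (2 * N) (int N + j + 1))"
    unfolding qbin_Suc_alt by (simp add: algebra_simps)
  finally show ?thesis unfolding e by (simp add: algebra_simps)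
qed

lemma sum_shift_int:
  fixes y :: "int \<Rightarrow> 'a::comm_ring_1"
  assumes "\<And>j. \<bar>j\<bar> \<ge> int R \<Longrightarrow> y j = 0"
  shows "(\<Sum>j=- int R..int R. y (j + 1)) = (\<Sum>j=- int R..int R. y j)"
    and "(\<Sum>j=- int R..int R. y (j - 1)) = (\<Sum>j=- int R..int R. y j)"
  using sum_telescope_int[of y R] sum_telescope_int[of "\<lambda>j. y (j - 1)" R] assms
  by (simp_all add: sum_subtractf)

text \<open>
  The finite triple product (Cauchy) in base \<open>q ^ 5\<close> with \<open>z = q ^ (3 - 2 * c)\<close>. The powers of z and
  the triangular powers of \<open>q ^ 5\<close> together form the theta term.
\<close>

lemma jacobi_finite:
  fixes q :: "'a::comm_ring_1"
  assumes c: "c \<le> 1" and R: "N < R"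
  shows "(\<Sum>j=- int R..int R. theta q c j * qbin (q ^ 5) (2 * N) (int N + j)) = triple_prod q c N"
  using R
proof (induction N)
  case 0
  have "(\<Sum>j=- int R..int R. theta q c j * qbin (q ^ 5) (2 * 0) (int 0 + j)) =
     (\<Sum>j\<in>{0}. theta q c j * qbin (q ^ 5) (2 * 0) (int 0 + j))"
    by (rule sum.mono_neutral_right) auto
  then show ?case by (simp add: theta_def theta_exp_def triple_prod_def)
next
  case (Suc N)
  define y where "y = (\<lambda>j. theta q c j * qbin (q ^ 5) (2 * N) (int N + j))"
  have y0: "y j = 0" if "\<bar>j\<bar> \<ge> int R" for j
    using that Suc.prems unfolding y_def by (subst qbin_eq_0) auto
  have a1: "theta q c j * ((q ^ 5) ^ nat (int N + 1 - j) * qbin (q ^ 5) (2 * N) (int N + j - 1))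
      = - (q ^ (5 * N + 3 - 2 * c)) * y (j - 1)" for j
  proof (cases "0 \<le> int N + j - 1 \<and> int N + j - 1 \<le> 2 * int N")
    case True
    have "theta q c (j - 1 + 1) * q ^ nat (5 * (int N + 1 - j)) = - (theta q c (j - 1) * q ^ nat (5 * int N + 3 - 2 * int c))"
      by (rule theta_shift[OF c]) (use True c in auto)
    moreover have "nat (5 * int N + 3 - 2 * int c) = 5 * N + 3 - 2 * c"
      using c by linarith
    moreover have "nat (5 * (int N + 1 - j)) = 5 * nat (int N + 1 - j)"
      by (simp only: nat_mult_distrib nat_numeral)
    ultimately have "theta q c j * (q ^ 5) ^ nat (int N + 1 - j) = - (theta q c (j - 1) * q ^ (5 * N + 3 - 2 * c))"
      by (simp only: power_mult diff_add_cancel)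
    then show ?thesis
      unfolding mult.assoc[symmetric] by (simp add: y_def algebra_simps)
  next
    case False
    then show ?thesis by (auto simp: y_def qbin_eq_0)
  qed
  have a2: "theta q c j * ((q ^ 5) ^ nat (int N + 1 + j) * qbin (q ^ 5) (2 * N) (int N + j + 1))
      = - (q ^ (5 * N + 2 + 2 * c)) * y (j + 1)" for j
  proof (cases "0 \<le> int N + j + 1 \<and> int N + j + 1 \<le> 2 * int N")
    case True
    have "theta q c (j + 1) * q ^ nat (5 * int N + 2 + 2 * int c) = - (theta q c j * q ^ nat (5 * (int N + 1 + j)))"
      by (rule theta_shift[OF c]) (use True c in auto)
    moreover have "nat (5 * int N + 2 + 2 * int c) = 5 * N + 2 + 2 * c"
      using c by linarith
    moreover have "nat (5 * (int N + 1 + j)) = 5 * nat (int N + 1 + j)"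
      by (simp only: nat_mult_distrib nat_numeral)
    ultimately have "theta q c j * (q ^ 5) ^ nat (int N + 1 + j) = - (theta q c (j + 1) * q ^ (5 * N + 2 + 2 * c))"
      by (simp only: power_mult minus_minus)
    then show ?thesis
      unfolding mult.assoc[symmetric] by (simp add: y_def algebra_simps)
  next
    case False
    then show ?thesis by (auto simp: y_def qbin_eq_0)
  qed
  have "theta q c j * qbin (q ^ 5) (2 * Suc N) (int (Suc N) + j) =
     (1 + q ^ (10 * N + 5)) * y j - q ^ (5 * N + 3 - 2 * c) * y (j - 1) - q ^ (5 * N + 2 + 2 * c) * y (j + 1)" for j
  proof -
    have i: "2 * Suc N = 2 * N + 2" "int (Suc N) + j = int N + 1 + j" by auto
    show ?thesis
      unfolding i qbin_add2 distrib_left a1 a2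
      by (simp add: y_def algebra_simps power_add flip: power_mult)
  qed
  then have "(\<Sum>j=- int R..int R. theta q c j * qbin (q ^ 5) (2 * Suc N) (int (Suc N) + j)) =
     (1 + q ^ (10 * N + 5)) * (\<Sum>j=- int R..int R. y j)
     - q ^ (5 * N + 3 - 2 * c) * (\<Sum>j=- int R..int R. y (j - 1))
     - q ^ (5 * N + 2 + 2 * c) * (\<Sum>j=- int R..int R. y (j + 1))"
    by (simp add: sum_subtractf sum_distrib_left del: mult_Suc_right)
  also have "\<dots> = (1 + q ^ (10 * N + 5) - q ^ (5 * N + 3 - 2 * c) - q ^ (5 * N + 2 + 2 * c)) * triple_prod q c N"
    using sum_shift_int[of R y] y0 Suc by (simp add: y_def algebra_simps)
  also have "q ^ (10 * N + 5) = q ^ (5 * N + 3 - 2 * c) * q ^ (5 * N + 2 + 2 * c)"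
  proof -
    have "10 * N + 5 = (5 * N + 3 - 2 * c) + (5 * N + 2 + 2 * c)" using c by linarith
    then show ?thesis by (simp only: power_add)
  qed
  finally show ?case by (simp add: triple_prod_def algebra_simps)
qed

section \<open>Congruence of power series and the limit\<close>

text \<open>
  Congruence modulo \<open>fps_X ^ T\<close>. It takes the place of limits: every limit that a proof by
  infinite products would use becomes a congruence for large enough finite indices.
\<close>

definition fcong :: "nat \<Rightarrow> 'a::comm_ring_1 fps \<Rightarrow> 'a fps \<Rightarrow> bool" where
  "fcong T f g \<longleftrightarrow> (\<forall>i<T. fps_nth f i = fps_nth g i)"

lemma fcong_refl [simp, intro]: "fcong T f f"
  by (simp add: fcong_def)

lemma fcong_sym: "fcong T f g \<Longrightarrow> fcong T g f"
  by (simp add: fcong_def)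

lemma fcong_trans [trans]: "fcong T f g \<Longrightarrow> fcong T g h \<Longrightarrow> fcong T f h"
  by (simp add: fcong_def)

lemma fcong_mult:
  assumes "fcong T f g" "fcong T h k"
  shows "fcong T (f * h) (g * k)"
  unfolding fcong_def fps_mult_nth
  by (intro allI impI sum.cong refl) (use assms in \<open>auto simp: fcong_def\<close>)

lemma fcong_sum: "(\<And>j. j \<in> J \<Longrightarrow> fcong T (f j) (g j)) \<Longrightarrow> fcong T (sum f J) (sum g J)"
  unfolding fcong_def fps_sum_nth by (auto intro: sum.cong)

lemma fcong_X_power_mult: "T \<le> n \<Longrightarrow> fcong T (fps_X ^ n * f) 0"
  by (simp add: fcong_def fps_X_power_mult_nth)

lemma fcong_cancel:
  fixes f g u :: "'a::field fps"
  assumes "fcong T (u * f) (u * g)" and u: "fps_nth u 0 \<noteq> 0"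
  shows "fcong T f g"
proof -
  have "fcong T (inverse u * (u * f)) (inverse u * (u * g))"
    by (intro fcong_mult assms fcong_refl)
  then show ?thesis using inverse_mult_eq_1[OF u] by (simp flip: mult.assoc)
qed

lemma qpoch_nth_0: "d > 0 \<Longrightarrow> fps_nth (qpoch (fps_X ^ d :: 'a::comm_ring_1 fps) n) 0 = 1"
  by (induction n) (simp_all flip: power_mult power_add)

lemma fcong_qpoch:
  assumes "d > 0" "T \<le> Suc r" "r \<le> n"
  shows "fcong T (qpoch (fps_X ^ d :: 'a::comm_ring_1 fps) n) (qpoch (fps_X ^ d) r)"
  using assms(3)
proof (induction n rule: dec_induct)
  case base
  then show ?case by simp
next
  case (step n)
  have "fcong T (1 - (fps_X ^ d) ^ Suc n :: 'a fps) 1"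
  proof -
    have "T \<le> d * Suc n"
      using assms step(1) by (metis One_nat_def Suc_leI Suc_le_mono le_trans mult_le_mono nat_mult_1)
    then show ?thesis
      unfolding power_mult[symmetric] by (auto simp: fcong_def)
  qed
  from fcong_mult[OF step.IH this] show ?case by simp
qed

text \<open>
  A Gaussian coefficient far away from both ends tends to the inverse of the infinite Pochhammer
  product. With U the Pochhammer product of length r, all three products in
  \<open>qbin q n b * (qpoch q b * qpoch q (n - b)) = qpoch q n\<close> are congruent to U, and U is a
  unit.
\<close>

lemma fcong_qbin_qpoch:
  assumes d: "d > 0" and b: "int T \<le> b + 1" "int T \<le> int n - b + 1" "0 \<le> b" "b \<le> int n" and K: "T \<le> K + 1"
  shows "fcong T (qbin (fps_X ^ d :: 'a::field fps) n b * qpoch (fps_X ^ d) K) 1"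
proof -
  define q where "q = (fps_X ^ d :: 'a fps)"
  obtain a where a: "b = int a" "a \<le> n" using b by (metis nonneg_int_cases of_nat_le_iff)
  define r where "r = T - 1"
  let ?U = "qpoch q r"
  have r: "T \<le> Suc r" "r \<le> a" "r \<le> n - a" "r \<le> n" "r \<le> K"
    using a b K by (auto simp: r_def)
  have c: "fcong T (qpoch q m) ?U" if "r \<le> m" for m
    unfolding q_def using that r by (intro fcong_qpoch d) auto
  have "fcong T (qbin q n b * (?U * ?U)) (qbin q n b * (qpoch q a * qpoch q (n - a)))"
    by (intro fcong_mult fcong_refl fcong_sym[OF c] r)
  also have "qbin q n b * (qpoch q a * qpoch q (n - a)) = qpoch q n"
    unfolding a(1) by (rule qbin_mult_qpoch[OF a(2)])
  also have "fcong T (qpoch q n) ?U" by (intro c r)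
  finally have "fcong T (?U * (qbin q n b * ?U)) (?U * 1)" by (simp add: algebra_simps)
  then have "fcong T (qbin q n b * ?U) 1"
    by (rule fcong_cancel) (simp add: q_def qpoch_nth_0[OF d])
  moreover have "fcong T (qbin q n b * qpoch q K) (qbin q n b * ?U)"
    by (intro fcong_mult fcong_refl c r)
  ultimately show ?thesis unfolding q_def by (blast intro: fcong_trans)
qed

text \<open>
  Weights that are congruent to 1 near j = 0 do not affect the theta series: far from 0 the theta
  terms are themselves congruent to 0.
\<close>

lemma fcong_theta_sum:
  fixes a :: "int \<Rightarrow> 'a::field fps"
  assumes c: "c \<le> 1" and a: "\<And>j. \<bar>j\<bar> < int T \<Longrightarrow> fcong T (a j) 1"
  shows "fcong T (\<Sum>j=- int R..int R. theta fps_X c j * a j) (\<Sum>j=- int R..int R. theta fps_X c j)"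
proof (rule fcong_sum)
  fix j
  show "fcong T (theta fps_X c j * a j) (theta fps_X c j)"
  proof (cases "\<bar>j\<bar> < int T")
    case True
    then show ?thesis using fcong_mult[OF fcong_refl a[OF True], of "theta fps_X c j"] by simp
  next
    case False
    then have T: "T \<le> nat (theta_exp c j)" using theta_exp_ge[OF c, of j] by linarith
    have "fcong T (theta fps_X c j * g) 0" for g :: "'a fps"
    proof -
      have "theta fps_X c j * g = fps_X ^ nat (theta_exp c j) * ((if even j then 1 else -1) * g)"
        by (simp add: theta_def)
      then show ?thesis using fcong_X_power_mult[OF T] by metis
    qed
    from this[of 1] this[of "a j"] show ?thesis by (auto simp: fcong_def)
  qed
qed

section \<open>Comparison of the two finite identities\<close>

definition rr_set :: "nat \<Rightarrow> nat set" where
  "rr_set c = {a. 0 < a \<and> (a mod 5 = 1 + c \<or> a mod 5 = 4 - c)}"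

text \<open>
  The reciprocal of the generating function of the partitions into parts from S up to N.
\<close>

definition euler_prod :: "nat set \<Rightarrow> nat \<Rightarrow> 'a::comm_ring_1 \<Rightarrow> 'a" where
  "euler_prod S N q = (\<Prod>i=1..N. if i \<in> S then 1 - q ^ i else 1)"

text \<open>
  The residues modulo 5 other than those of \<open>rr_set c\<close> are 0 and 3 - 2c, 2 + 2c. The class 0 gives
  the Pochhammer product in base \<open>q ^ 5\<close>, the other two give the triple product.
\<close>

lemma qpoch_split:
  assumes "c \<le> 1"
  shows "qpoch q (5 * N) = triple_prod q c N * qpoch (q ^ 5) N * euler_prod (rr_set c) (5 * N) q"
proof (induction N)
  case 0
  then show ?case by (simp add: triple_prod_def euler_prod_def)
next
  case (Suc N)
  have e: "5 * Suc N = Suc (Suc (Suc (Suc (Suc (5 * N)))))" by simp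
  have m: "Suc (5 * N) mod 5 = 1" "Suc (Suc (5 * N)) mod 5 = 2" "Suc (Suc (Suc (5 * N))) mod 5 = 3"
     "Suc (Suc (Suc (Suc (5 * N)))) mod 5 = 4" "Suc (Suc (Suc (Suc (Suc (5 * N))))) mod 5 = 0"
    by presburger+
  have 5: "(q ^ 5) ^ Suc N = q ^ Suc (Suc (Suc (Suc (Suc (5 * N)))))"
    by (simp only: power_mult[symmetric]) (rule arg_cong[of _ _ "power q"], simp)
  consider "c = 0" | "c = 1" using assms by linarith
  then show ?case
  proof cases
    case 1
    have x: "5 * N + 3 - 2 * c = Suc (Suc (Suc (5 * N)))" "5 * N + 2 + 2 * c = Suc (Suc (5 * N))"
      using 1 by auto
    have s: "Suc (5 * N) \<in> rr_set c" "Suc (Suc (5 * N)) \<notin> rr_set c" "Suc (Suc (Suc (5 * N))) \<notin> rr_set c"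
      "Suc (Suc (Suc (Suc (5 * N)))) \<in> rr_set c" "Suc (Suc (Suc (Suc (Suc (5 * N))))) \<notin> rr_set c"
      unfolding rr_set_def mem_Collect_eq m 1 by simp_all
    have t: "triple_prod q c (Suc N) = triple_prod q c N * ((1 - q ^ Suc (Suc (Suc (5 * N)))) * (1 - q ^ Suc (Suc (5 * N))))"
      unfolding triple_prod_def prod.lessThan_Suc x ..
    have ep: "euler_prod (rr_set c) (5 * Suc N) q =
        euler_prod (rr_set c) (5 * N) q * (1 - q ^ Suc (5 * N)) * (1 - q ^ Suc (Suc (Suc (Suc (5 * N)))))"
      unfolding e euler_prod_def by (simp add: s del: power_Suc)
    show ?thesis
      unfolding t ep unfolding e qpoch_Suc 5 Suc by (simp only: mult_ac)
  next
    case 2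
    have x: "5 * N + 3 - 2 * c = Suc (5 * N)" "5 * N + 2 + 2 * c = Suc (Suc (Suc (Suc (5 * N))))"
      using 2 by auto
    have s: "Suc (5 * N) \<notin> rr_set c" "Suc (Suc (5 * N)) \<in> rr_set c" "Suc (Suc (Suc (5 * N))) \<in> rr_set c"
      "Suc (Suc (Suc (Suc (5 * N)))) \<notin> rr_set c" "Suc (Suc (Suc (Suc (Suc (5 * N))))) \<notin> rr_set c"
      unfolding rr_set_def mem_Collect_eq m 2 by simp_all
    have t: "triple_prod q c (Suc N) = triple_prod q c N * ((1 - q ^ Suc (5 * N)) * (1 - q ^ Suc (Suc (Suc (Suc (5 * N))))))"
      unfolding triple_prod_def prod.lessThan_Suc x ..
    have ep: "euler_prod (rr_set c) (5 * Suc N) q =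
        euler_prod (rr_set c) (5 * N) q * (1 - q ^ Suc (Suc (5 * N))) * (1 - q ^ Suc (Suc (Suc (5 * N))))"
      unfolding e euler_prod_def by (simp add: s del: power_Suc)
    show ?thesis
      unfolding t ep unfolding e qpoch_Suc 5 Suc by (simp only: mult_ac)
  qed
qed

text \<open>
  The analytic core. Both Schur's sum times \<open>qpoch q (10 * T)\<close> and the triple product times
  \<open>qpoch (q ^ 5) (2 * T)\<close> are congruent to the theta series. Since the latter is a factor of
  \<open>qpoch q (10 * T)\<close>, it cancels and leaves the Euler product over \<open>rr_set c\<close>. The indices 8T and
  2T are chosen such that, for j of absolute value below T, the Gaussian coefficients that occur
  have their lower index at distance at least T from both ends; 10T is 5 times 2T.
\<close>

lemma euler_prod_mult_schur:
  assumes c: "c \<le> 1" and T: "T \<ge> 1"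
  shows "fcong T (euler_prod (rr_set c) (10 * T) fps_X * schur fps_X c (8 * T) (8 * T)) (1 :: 'a::field fps)"
proof -
  define q where "q = (fps_X :: 'a fps)"
  define R where "R = 8 * T"
  let ?A = "triple_prod q c (2 * T) * qpoch (q ^ 5) (2 * T)"
  let ?Th = "\<Sum>j=- int R..int R. theta q c j"
  have q: "qpoch q (10 * T) = ?A * euler_prod (rr_set c) (10 * T) q"
    using qpoch_split[OF c, of q "2 * T"] by simp
  have "fcong T (\<Sum>j=- int R..int R. theta q c j *
     (qbin q (8 * T) ((int (8 * T) - 5 * j) div 2 + int c) * qpoch q (10 * T))) ?Th"
    unfolding q_def
  proof (rule fcong_theta_sum[OF c])
    fix j :: int assume "\<bar>j\<bar> < int T"
    then have b: "int T \<le> ((int (8 * T) - 5 * j) div 2 + int c)" "((int (8 * T) - 5 * j) div 2 + int c) \<le> 7 * int T"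
      using c T half_bounds[of "int (8 * T) - 5 * j"] by linarith+
    show "fcong T (qbin fps_X (8 * T) ((int (8 * T) - 5 * j) div 2 + int c) * qpoch fps_X (10 * T)) (1 :: 'a fps)"
      using fcong_qbin_qpoch[of 1 T "(int (8 * T) - 5 * j) div 2 + int c" "8 * T" "10 * T", where 'a = 'a] b
      by simp
  qed
  then have 1: "fcong T (qpoch q (10 * T) * schur q c (8 * T) (8 * T)) ?Th"
    unfolding schur_def R_def sum_distrib_left by (simp only: mult_ac)
  have "fcong T (\<Sum>j=- int R..int R. theta q c j *
     (qbin (q ^ 5) (2 * (2 * T)) (int (2 * T) + j) * qpoch (q ^ 5) (2 * T))) ?Th"
    unfolding q_def
    by (intro fcong_theta_sum[OF c] fcong_qbin_qpoch) auto
  then have "fcong T ((\<Sum>j=- int R..int R. theta q c j * qbin (q ^ 5) (2 * (2 * T)) (int (2 * T) + j)) * qpoch (q ^ 5) (2 * T)) ?Th"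
    unfolding sum_distrib_right by (simp only: mult_ac)
  also have "(\<Sum>j=- int R..int R. theta q c j * qbin (q ^ 5) (2 * (2 * T)) (int (2 * T) + j)) = triple_prod q c (2 * T)"
    by (rule jacobi_finite[OF c]) (use T in \<open>simp add: R_def\<close>)
  finally have "fcong T ?A ?Th" .
  from fcong_trans[OF 1 fcong_sym[OF this]]
  have "fcong T (?A * (euler_prod (rr_set c) (10 * T) q * schur q c (8 * T) (8 * T))) (?A * 1)"
    by (simp only: q mult.assoc mult_1_right)
  moreover have "fps_nth (qpoch q (10 * T)) 0 \<noteq> 0"
    using qpoch_nth_0[of 1, where 'a = 'a] by (simp add: q_def)
  then have "fps_nth ?A 0 \<noteq> 0"
    by (simp add: q)
  ultimately show ?thesis unfolding q_def by (rule fcong_cancel)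
qed

section \<open>Partitions with difference at least 2\<close>

lemma is_partition_Nil [simp]: "is_partition n [] \<longleftrightarrow> n = 0"
  by (auto simp: is_partition_def)

lemma is_partition_Cons:
  "is_partition n (x # xs) \<longleftrightarrow> 1 \<le> x \<and> x \<le> n \<and> (\<forall>a\<in>set xs. a \<le> x) \<and> is_partition (n - x) xs"
  by (auto simp: is_partition_def)

lemma is_partition_le: "is_partition n \<mu> \<Longrightarrow> a \<in> set \<mu> \<Longrightarrow> a \<le> n"
  by (auto simp: is_partition_def intro: member_le_sum_list)

lemma difference_ge2_simps [simp]:
  "difference_ge2 []" "difference_ge2 [x]"
  "difference_ge2 (x # y # ys) \<longleftrightarrow> y + 2 \<le> x \<and> difference_ge2 (y # ys)"
proof -
  show "difference_ge2 (x # y # ys) \<longleftrightarrow> y + 2 \<le> x \<and> difference_ge2 (y # ys)"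
  proof
    assume *: "difference_ge2 (x # y # ys)"
    have "difference_ge2 (y # ys)"
      unfolding difference_ge2_def
    proof (intro allI impI)
      fix i assume "Suc i < length (y # ys)"
      then show "int ((y # ys) ! i) - int ((y # ys) ! Suc i) \<ge> 2"
        using *[unfolded difference_ge2_def, rule_format, of "Suc i"] by simp
    qed
    then show "y + 2 \<le> x \<and> difference_ge2 (y # ys)"
      using *[unfolded difference_ge2_def, rule_format, of 0] by simp
  next
    assume *: "y + 2 \<le> x \<and> difference_ge2 (y # ys)"
    show "difference_ge2 (x # y # ys)"
      unfolding difference_ge2_def
    proof (intro allI impI)
      fix i assume "Suc i < length (x # y # ys)"
      then show "int ((x # y # ys) ! i) - int ((x # y # ys) ! Suc i) \<ge> 2"
        using * by (cases i) (auto simp: difference_ge2_def)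
    qed
  qed
qed (simp_all add: difference_ge2_def)

text \<open>
  For c = 1 the bound on the parts excludes the part 1; for c = 0 it is void.
\<close>

definition rr_partitions :: "nat \<Rightarrow> nat \<Rightarrow> nat list set" where
  "rr_partitions c n = {\<nu>. is_partition n \<nu> \<and> difference_ge2 \<nu> \<and> (\<forall>a\<in>set \<nu>. c < a)}"

definition rr_below :: "nat \<Rightarrow> nat \<Rightarrow> nat \<Rightarrow> nat list set" where
  "rr_below c N n = {\<nu> \<in> rr_partitions c n. \<forall>a\<in>set \<nu>. a < N}"

lemma finite_rr_partitions [simp]: "finite (rr_partitions c n)"
  by (rule finite_subset[OF _ finite_is_partition[of n]]) (auto simp: rr_partitions_def)

lemma finite_rr_below [simp]: "finite (rr_below c N n)"
  by (simp add: rr_below_def)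

text \<open>
  If the largest part is N + 1, the others are at most N - 1, that is, below N. The hypothesis
  says that N + 1 is an admissible part.
\<close>

lemma rr_below_rec:
  assumes "c \<le> N"
  shows "rr_below c (N + 2) n = rr_below c (N + 1) n \<union>
    (if N + 1 \<le> n then (#) (N + 1) ` rr_below c N (n - (N + 1)) else {})" (is "?L = ?R")
proof (rule set_eqI)
  fix \<nu>
  show "\<nu> \<in> ?L \<longleftrightarrow> \<nu> \<in> ?R"
  proof (cases \<nu>)
    case Nil
    then show ?thesis by (auto simp: rr_below_def rr_partitions_def)
  next
    case (Cons x xs)
    show ?thesis
    proof (cases "x = N + 1")
      case True
      have "(x # xs) \<in> ?L \<longleftrightarrow> N + 1 \<le> n \<and> xs \<in> rr_below c N (n - (N + 1))"
        using assms True
        by (cases xs) (fastforce simp: rr_below_def rr_partitions_def is_partition_Cons)+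
      moreover have "(x # xs) \<notin> rr_below c (N + 1) n"
        using True by (auto simp: rr_below_def)
      ultimately show ?thesis using Cons True by auto
    next
      case False
      have "x # xs \<in> ?L \<longleftrightarrow> x # xs \<in> rr_below c (N + 1) n"
        using False by (auto simp: rr_below_def rr_partitions_def is_partition_Cons)
      then show ?thesis using Cons False by auto
    qed
  qed
qed

lemma card_rr_below_rec:
  assumes "c \<le> N"
  shows "card (rr_below c (N + 2) n) = card (rr_below c (N + 1) n) +
    (if N + 1 \<le> n then card (rr_below c N (n - (N + 1))) else 0)"
proof -
  have "rr_below c (N + 1) n \<inter> (#) (N + 1) ` A = {}" for A
    by (auto simp: rr_below_def)
  then show ?thesis
    unfolding rr_below_rec[OF assms] by (auto simp: card_Un_disjoint card_image)
qed

lemma rr_below_init: "N \<le> Suc c \<Longrightarrow> rr_below c N n = (if n = 0 then {[]} else {})"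
proof -
  assume N: "N \<le> Suc c"
  have "\<nu> \<in> rr_below c N n \<longleftrightarrow> \<nu> = [] \<and> n = 0" for \<nu>
    using N by (cases \<nu>) (auto simp: rr_below_def rr_partitions_def)
  then show ?thesis by auto
qed

definition rr_gf :: "nat \<Rightarrow> nat \<Rightarrow> 'a::comm_ring_1 fps" where
  "rr_gf c N = Abs_fps (\<lambda>n. of_nat (card (rr_below c N n)))"

lemma rr_gf_rec: "c \<le> N \<Longrightarrow> rr_gf c (N + 2) = rr_gf c (N + 1) + fps_X ^ (N + 1) * rr_gf c N"
  using card_rr_below_rec[of c N]
  by (intro fps_ext) (simp add: rr_gf_def fps_X_power_mult_nth del: power_Suc)

lemma rr_gf_init: "N \<le> Suc c \<Longrightarrow> rr_gf c N = 1"
  by (rule fps_ext) (simp add: rr_gf_def rr_below_init)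

text \<open>
  Equal recurrences and equal initial values. The induction starts at c because for c = 1 and N = 0
  the generating function is 1, whereas Schur's sum is 0.
\<close>

lemma rr_gf_eq_schur:
  assumes c: "c \<le> 1" and "c \<le> N" "N \<le> R"
  shows "rr_gf c N = schur fps_X c R N"
  using assms(2,3)
proof (induction N rule: less_induct)
  case (less N)
  consider "N = c" | "N = Suc c" | m where "N = m + 2" "c \<le> m"
  proof -
    have "N = c \<or> N = Suc c \<or> (N = (N - 2) + 2 \<and> c \<le> N - 2)" using less.prems by linarith
    then show thesis using that by blast
  qed
  then show ?case
  proof cases
    case 3
    then show ?thesis
      using less.IH[of m] less.IH[of "m + 1"] less.prems schur_rec[OF c, of m R "fps_X :: 'a fps"]
      by (simp add: rr_gf_rec[of c m, simplified])
  qed (use c schur_init in \<open>auto simp: rr_gf_init le_Suc_eq numeral_2_eq_2\<close>)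
qed

section \<open>Partitions into parts from a set, and the Rogers--Ramanujan identities\<close>

definition bounded_partitions :: "nat set \<Rightarrow> nat \<Rightarrow> nat \<Rightarrow> nat list set" where
  "bounded_partitions S N n = {\<mu> \<in> partitions_into S n. \<forall>a\<in>set \<mu>. a \<le> N}"

lemma finite_partitions_into [simp]: "finite (partitions_into S n)"
  by (rule finite_subset[OF _ finite_is_partition[of n]]) (auto simp: partitions_into_def)

lemma finite_bounded_partitions [simp]: "finite (bounded_partitions S N n)"
  by (simp add: bounded_partitions_def)

text \<open>
  Either the largest part is below \<open>Suc N\<close>, or one copy of \<open>Suc N\<close> can be removed, after which
  \<open>Suc N\<close> may still occur.
\<close>

lemma bounded_partitions_rec:
  "bounded_partitions S (Suc N) n = bounded_partitions S N n \<union>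
    (if Suc N \<in> S \<and> Suc N \<le> n then (#) (Suc N) ` bounded_partitions S (Suc N) (n - Suc N) else {})"
  (is "?L = ?R")
proof (rule set_eqI)
  fix \<mu>
  show "\<mu> \<in> ?L \<longleftrightarrow> \<mu> \<in> ?R"
  proof (cases \<mu>)
    case Nil
    then show ?thesis by (auto simp: bounded_partitions_def partitions_into_def)
  next
    case (Cons x xs)
    show ?thesis
    proof (cases "x = Suc N")
      case True
      have "(x # xs) \<in> ?L \<longleftrightarrow> Suc N \<in> S \<and> Suc N \<le> n \<and> xs \<in> bounded_partitions S (Suc N) (n - Suc N)"
        using True by (auto simp: bounded_partitions_def partitions_into_def is_partition_Cons)
      moreover have "(x # xs) \<notin> bounded_partitions S N n"
        using True by (auto simp: bounded_partitions_def)
      ultimately show ?thesis using Cons True by auto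
    next
      case False
      have "x # xs \<in> ?L \<longleftrightarrow> x # xs \<in> bounded_partitions S N n"
        using False by (auto simp: bounded_partitions_def partitions_into_def is_partition_Cons)
      then show ?thesis using Cons False by auto
    qed
  qed
qed

definition part_gf :: "nat set \<Rightarrow> nat \<Rightarrow> 'a::comm_ring_1 fps" where
  "part_gf S N = Abs_fps (\<lambda>n. of_nat (card (bounded_partitions S N n)))"

lemma part_gf_Suc:
  "part_gf S (Suc N) * (if Suc N \<in> S then 1 - fps_X ^ Suc N else 1) = part_gf S N"
proof -
  have "bounded_partitions S N n \<inter> (#) (Suc N) ` A = {}" for A n
    by (auto simp: bounded_partitions_def)
  then have "card (bounded_partitions S (Suc N) n) = card (bounded_partitions S N n) +
      (if Suc N \<in> S \<and> Suc N \<le> n then card (bounded_partitions S (Suc N) (n - Suc N)) else 0)" for n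
    by (subst bounded_partitions_rec) (auto simp: card_Un_disjoint card_image)
  then have "part_gf S (Suc N) = part_gf S N + (if Suc N \<in> S then fps_X ^ Suc N * part_gf S (Suc N) else 0)"
    by (intro fps_ext) (auto simp: part_gf_def fps_X_power_mult_nth simp del: power_Suc)
  then show ?thesis by (auto simp: algebra_simps simp del: power_Suc)
qed

lemma part_gf_mult_euler_prod: "part_gf S N * euler_prod S N (fps_X :: 'a::comm_ring_1 fps) = 1"
proof (induction N)
  case 0
  have "\<mu> \<in> bounded_partitions S 0 n \<longleftrightarrow> \<mu> = [] \<and> n = 0" for \<mu> n
    by (cases \<mu>) (auto simp: bounded_partitions_def partitions_into_def is_partition_Cons)
  then have "bounded_partitions S 0 n = (if n = 0 then {[]} else {})" for n by auto
  then have "part_gf S 0 = (1 :: 'a fps)" by (intro fps_ext) (simp add: part_gf_def)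
  then show ?case by (simp add: euler_prod_def)
next
  case (Suc N)
  have "euler_prod S (Suc N) (fps_X :: 'a fps) = (if Suc N \<in> S then 1 - fps_X ^ Suc N else 1) * euler_prod S N fps_X"
    by (simp add: euler_prod_def)
  then have "part_gf S (Suc N) * euler_prod S (Suc N) (fps_X :: 'a fps) =
      (part_gf S (Suc N) * (if Suc N \<in> S then 1 - fps_X ^ Suc N else 1)) * euler_prod S N fps_X"
    by (simp only: mult.assoc)
  then show ?case by (simp only: part_gf_Suc Suc)
qed

text \<open>
  Modulo \<open>fps_X ^ (n + 1)\<close> the generating functions of the partitions with difference at least 2 and
  of the partitions into parts from \<open>rr_set c\<close> are both inverse to the same Euler product. The bounds
  on the parts lie above n and therefore do not restrict the partitions of n.
\<close>

theorem rogers_ramanujan: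
  assumes c: "c \<le> 1"
  shows "card (partitions_into (rr_set c) n) = card (rr_partitions c n)"
proof -
  define T where "T = Suc n"
  let ?E = "euler_prod (rr_set c) (10 * T) fps_X :: rat fps"
  have "fcong T (?E * rr_gf c (8 * T)) 1"
    using euler_prod_mult_schur[OF c, of T] c by (subst rr_gf_eq_schur[OF c, of _ "8 * T"]) (auto simp: T_def)
  then have "fcong T (part_gf (rr_set c) (10 * T) * (?E * rr_gf c (8 * T))) (part_gf (rr_set c) (10 * T) * 1)"
    by (intro fcong_mult fcong_refl)
  then have "fcong T (rr_gf c (8 * T)) (part_gf (rr_set c) (10 * T) :: rat fps)"
    by (simp add: part_gf_mult_euler_prod flip: mult.assoc)
  then have "card (rr_below c (8 * T) n) = card (bounded_partitions (rr_set c) (10 * T) n)"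
    by (simp add: fcong_def T_def rr_gf_def part_gf_def)
  moreover have "rr_below c (8 * T) n = rr_partitions c n"
    using is_partition_le by (fastforce simp: rr_below_def rr_partitions_def T_def)
  moreover have "bounded_partitions (rr_set c) (10 * T) n = partitions_into (rr_set c) n"
    using is_partition_le by (fastforce simp: bounded_partitions_def partitions_into_def T_def)
  ultimately show ?thesis by simp
qed

section \<open>Containing copies of a partition\<close>

definition add_copies :: "nat \<Rightarrow> nat list \<Rightarrow> nat list \<Rightarrow> nat list" where
  "add_copies k lam \<mu> = rev (sort (\<mu> @ concat (replicate k lam)))"

lemma mset_concat_replicate: "mset (concat (replicate k xs)) = repeat_mset k (mset xs)"
  by (induction k) auto

lemma mset_add_copies: "mset (add_copies k lam \<mu>) = mset \<mu> + repeat_mset k (mset lam)"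
  by (simp add: add_copies_def mset_concat_replicate)

text \<open>
  A partition is a sorted list, hence determined by its multiset of parts. This lets the removal of copies
  of a partition be a subtraction of multisets.
\<close>

lemma partition_eqI:
  assumes "is_partition n \<mu>" "is_partition m \<nu>" "mset \<mu> = mset \<nu>"
  shows "\<mu> = \<nu>"
proof -
  have "rev \<mu> = sort \<mu>" "rev \<nu> = sort \<nu>"
    using assms by (auto simp: is_partition_def sorted_wrt_rev
        intro!: properties_for_sort[symmetric])
  then show ?thesis using assms(3) by (metis rev_rev_ident sorted_list_of_multiset_mset)
qed

lemma partition_of_mset:
  assumes "\<forall>a\<in>#X. 1 \<le> a \<and> a \<in> S"
  shows "rev (sorted_list_of_multiset X) \<in> partitions_into S (sum_mset X)"
  using assms
  by (auto simp: partitions_into_def is_partition_def sorted_wrt_rev sorted_sorted_list_of_multiset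
      simp flip: sum_mset_sum_list)

text \<open>
  Adding k copies of \<open>lam\<close> is a bijection from the partitions of \<open>n - k * M\<close> onto the partitions of n
  that contain k copies of \<open>lam\<close>; its inverse removes them.
\<close>

lemma card_contains_copies:
  assumes lam: "lam \<in> partitions_into S M"
  shows "card {\<mu> \<in> partitions_into S n. \<forall>a\<in>set lam. k * count_list lam a \<le> count_list \<mu> a} =
    (if k * M \<le> n then card (partitions_into S (n - k * M)) else 0)" (is "card ?C = _")
proof -
  have sub: "repeat_mset k (mset lam) \<subseteq># mset \<mu>" if "\<mu> \<in> ?C" for \<mu>
  proof (rule mset_subset_eqI)
    fix a show "count (repeat_mset k (mset lam)) a \<le> count (mset \<mu>) a"
      using that by (cases "a \<in> set lam") (auto simp: count_mset count_list_0_iff)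
  qed
  have sumlam: "sum_mset (repeat_mset k (mset lam)) = k * M"
    using lam by (induction k) (simp_all add: partitions_into_def is_partition_def sum_mset_sum_list)
  show ?thesis
  proof (cases "k * M \<le> n")
    case False
    have "?C = {}"
    proof (rule ccontr)
      assume "?C \<noteq> {}"
      then obtain \<mu> where \<mu>: "\<mu> \<in> ?C" by blast
      from sub[OF \<mu>] obtain Y where "mset \<mu> = repeat_mset k (mset lam) + Y"
        by (metis subset_mset.add_diff_inverse)
      then have "sum_mset (mset \<mu>) = k * M + sum_mset Y" using sumlam by simp
      moreover have "sum_mset (mset \<mu>) = n"
        using \<mu> by (simp add: partitions_into_def is_partition_def sum_mset_sum_list)
      ultimately show False using False by simp
    qed
    then show ?thesis using False by simp
  next
    case True
    have "bij_betw (add_copies k lam) (partitions_into S (n - k * M)) ?C"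
    proof (rule bij_betwI')
      fix \<mu> \<nu> assume a: "\<mu> \<in> partitions_into S (n - k * M)" "\<nu> \<in> partitions_into S (n - k * M)"
      show "add_copies k lam \<mu> = add_copies k lam \<nu> \<longleftrightarrow> \<mu> = \<nu>"
      proof
        assume "add_copies k lam \<mu> = add_copies k lam \<nu>"
        then have "mset \<mu> = mset \<nu>" by (metis mset_add_copies add_right_cancel)
        then show "\<mu> = \<nu>" using a by (auto simp: partitions_into_def intro: partition_eqI)
      qed simp
    next
      fix \<mu> assume a: "\<mu> \<in> partitions_into S (n - k * M)"
      have m: "mset (add_copies k lam \<mu>) = mset \<mu> + repeat_mset k (mset lam)"
        by (rule mset_add_copies)
      have "sum_list (add_copies k lam \<mu>) = n"
        using a True sumlam unfolding sum_mset_sum_list[symmetric] m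
        by (simp add: partitions_into_def is_partition_def sum_mset_sum_list)
      moreover have "set (add_copies k lam \<mu>) \<subseteq> set \<mu> \<union> set lam"
        by (auto simp: add_copies_def)
      moreover have "sorted_wrt (\<ge>) (add_copies k lam \<mu>)"
        by (simp add: add_copies_def sorted_wrt_rev)
      moreover have "count_list (add_copies k lam \<mu>) a = count_list \<mu> a + k * count_list lam a" for a
        unfolding count_mset[symmetric] m by simp
      moreover have "1 \<le> a" "a \<in> S" if "a \<in> set \<mu> \<union> set lam" for a
        using that a lam by (auto simp: partitions_into_def is_partition_def)
      ultimately show "add_copies k lam \<mu> \<in> ?C"
        unfolding partitions_into_def is_partition_def mem_Collect_eq by (auto 0 3)
    next
      fix \<nu> assume n: "\<nu> \<in> ?C"
      define X where "X = mset \<nu> - repeat_mset k (mset lam)"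
      have X: "mset \<nu> = X + repeat_mset k (mset lam)"
        using sub[OF n] by (simp add: X_def)
      have "\<nu> \<in> partitions_into S n" using n by simp
      then have \<nu>: "is_partition n \<nu>" "\<forall>a\<in>set \<nu>. 1 \<le> a \<and> a \<in> S" "sum_list \<nu> = n"
        by (auto simp: partitions_into_def is_partition_def)
      have "sum_mset (mset \<nu>) = n" using \<nu>(3) by (simp add: sum_mset_sum_list)
      then have s: "sum_mset X = n - k * M" using sumlam unfolding X by simp
      have "set_mset X \<subseteq> set \<nu>" unfolding X_def by (auto dest: in_diffD)
      then have "\<forall>a\<in>#X. 1 \<le> a \<and> a \<in> S" using \<nu>(2) by blast
      from partition_of_mset[OF this]
      have p: "rev (sorted_list_of_multiset X) \<in> partitions_into S (n - k * M)"
        unfolding s .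
      have m: "mset (add_copies k lam (rev (sorted_list_of_multiset X))) = mset \<nu>"
        unfolding mset_add_copies X by simp
      have "is_partition n (add_copies k lam (rev (sorted_list_of_multiset X)))"
      proof -
        have "sum_list (add_copies k lam (rev (sorted_list_of_multiset X))) = n"
          using m \<nu>(3) by (metis sum_mset_sum_list)
        moreover have "set (add_copies k lam (rev (sorted_list_of_multiset X))) = set \<nu>"
          using m by (rule mset_eq_setD)
        ultimately show ?thesis
          using \<nu>(2) by (simp add: is_partition_def) (simp add: add_copies_def sorted_wrt_rev)
      qed
      from partition_eqI[OF \<nu>(1) this m[symmetric]] p
      show "\<exists>\<mu>\<in>partitions_into S (n - k * M). \<nu> = add_copies k lam \<mu>" by blast
    qed
    then show ?thesis using True by (simp add: bij_betw_same_card)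
  qed
qed

lemma le_E_parts_iff:
  assumes "lam \<noteq> []"
  shows "k \<le> E_parts lam \<mu> \<longleftrightarrow> (\<forall>a\<in>set lam. k * count_list lam a \<le> count_list \<mu> a)"
proof -
  let ?J = "{j. \<forall>a\<in>set lam. j * count_list lam a \<le> count_list \<mu> a}"
  have fin: "finite ?J" by (rule finite_E_parts[OF assms])
  have "0 \<in> ?J" by simp
  then have "E_parts lam \<mu> \<in> ?J"
    unfolding E_parts_def using fin by (metis (no_types, lifting) Max_in empty_iff)
  then have "k \<in> ?J" if "k \<le> E_parts lam \<mu>" using that by (auto intro: order_trans mult_right_mono)
  moreover have "k \<le> E_parts lam \<mu>" if "k \<in> ?J"
    unfolding E_parts_def by (rule Max_ge[OF fin that])
  ultimately show ?thesis by auto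
qed

text \<open>
  The partitions with \<open>E_parts lam \<mu> = k\<close> are those that contain k copies but not k + 1 copies. The
  equation is stated as a sum to avoid subtraction of natural numbers.
\<close>

lemma E_count_eq:
  assumes lam: "lam \<in> partitions_into S M" and "M \<ge> 1"
  shows "E_count S lam n k + (if Suc k * M \<le> n then card (partitions_into S (n - Suc k * M)) else 0)
     = (if k * M \<le> n then card (partitions_into S (n - k * M)) else 0)"
proof -
  have ne: "lam \<noteq> []" using assms by (auto simp: partitions_into_def)
  let ?G = "\<lambda>k. {\<mu> \<in> partitions_into S n. k \<le> E_parts lam \<mu>}"
  have G: "card (?G k) = (if k * M \<le> n then card (partitions_into S (n - k * M)) else 0)" for k
    unfolding le_E_parts_iff[OF ne] by (rule card_contains_copies[OF lam])
  have "?G k = {\<mu> \<in> partitions_into S n. E_parts lam \<mu> = k} \<union> ?G (Suc k)" by auto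
  then have "card (?G k) = E_count S lam n k + card (?G (Suc k))"
    unfolding E_count_def by (subst card_Un_disjoint[symmetric]) auto
  then show ?thesis unfolding G by simp
qed

section \<open>The gap between the two largest parts\<close>

definition gap_ge :: "nat \<Rightarrow> nat \<Rightarrow> nat \<Rightarrow> nat list set" where
  "gap_ge c n d = {\<nu> \<in> rr_partitions c n. length \<nu> \<ge> 2 \<and> \<nu> ! 1 + 2 + d \<le> \<nu> ! 0}"

text \<open>
  Subtracting d from the largest part is a bijection: the gap is so large that the difference
  condition and the order of the parts survive.
\<close>

lemma gap_ge_shift:
  assumes "d \<le> n"
  shows "gap_ge c n d = (\<lambda>\<nu>. (hd \<nu> + d) # tl \<nu>) ` gap_ge c (n - d) 0" (is "_ = ?f ` _")
proof (intro equalityI subsetI)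
  fix \<nu> assume "\<nu> \<in> gap_ge c n d"
  then obtain x y ys where \<nu>: "\<nu> = x # y # ys" "y + 2 + d \<le> x" "\<nu> \<in> rr_partitions c n"
    by (cases \<nu> rule: remdups_adj.cases) (auto simp: gap_ge_def)
  have "(x - d) # y # ys \<in> gap_ge c (n - d) 0"
    using \<nu> by (auto simp: gap_ge_def rr_partitions_def is_partition_Cons)
  moreover have "\<nu> = ?f ((x - d) # y # ys)" using \<nu> by simp
  ultimately show "\<nu> \<in> ?f ` gap_ge c (n - d) 0" by blast
next
  fix \<nu> assume "\<nu> \<in> ?f ` gap_ge c (n - d) 0"
  then obtain \<mu> where \<mu>: "\<mu> \<in> gap_ge c (n - d) 0" "\<nu> = ?f \<mu>" by blast
  then obtain x y ys where "\<mu> = x # y # ys"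
    by (cases \<mu> rule: remdups_adj.cases) (auto simp: gap_ge_def)
  then show "\<nu> \<in> gap_ge c n d"
    using \<mu> assms by (auto simp: gap_ge_def rr_partitions_def is_partition_Cons add_ac)
qed

text \<open>
  For gap 0 the condition holds for all partitions with difference at least 2 and at least two parts. The
  correction counts those of \<open>n - d\<close> with at most one part: the empty partition if
  \<open>n = d\<close>, and the partition with the single part \<open>n - d\<close> if this part exceeds c.
\<close>

lemma card_gap_ge:
  assumes "c \<le> 1"
  shows "card (gap_ge c n d) + of_bool (d \<le> n \<and> (n = d \<or> c < n - d)) = (if d \<le> n then card (rr_partitions c (n - d)) else 0)"
proof (cases "d \<le> n")
  case True
  have "inj_on (\<lambda>\<nu>. (hd \<nu> + d) # tl \<nu>) (gap_ge c (n - d) 0)"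
  proof (rule inj_onI)
    fix \<mu> \<nu> assume "\<mu> \<in> gap_ge c (n - d) 0" "\<nu> \<in> gap_ge c (n - d) 0"
      "(hd \<mu> + d) # tl \<mu> = (hd \<nu> + d) # tl \<nu>"
    then show "\<mu> = \<nu>" by (cases \<mu>; cases \<nu>) (auto simp: gap_ge_def)
  qed
  then have g: "card (gap_ge c n d) = card (gap_ge c (n - d) 0)"
    unfolding gap_ge_shift[OF True] by (rule card_image)
  have short: "{\<nu> \<in> rr_partitions c m. length \<nu> < 2} = (if m = 0 then {[]} else if c < m then {[m]} else {})" for m
  proof -
    have "\<nu> \<in> rr_partitions c m \<and> length \<nu> < 2 \<longleftrightarrow> (m = 0 \<and> \<nu> = []) \<or> (c < m \<and> \<nu> = [m])" for \<nu>
      by (cases \<nu> rule: remdups_adj.cases) (auto simp: rr_partitions_def is_partition_Cons)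
    then show ?thesis by auto
  qed
  have "rr_partitions c (n - d) = gap_ge c (n - d) 0 \<union> {\<nu> \<in> rr_partitions c (n - d). length \<nu> < 2}"
  proof -
    have "\<nu> ! 1 + 2 \<le> \<nu> ! 0" if "difference_ge2 \<nu>" "length \<nu> \<ge> 2" for \<nu>
      using that by (cases \<nu> rule: remdups_adj.cases) auto
    then show ?thesis by (auto simp: gap_ge_def rr_partitions_def not_less)
  qed
  moreover have "finite (gap_ge c (n - d) 0)" by (simp add: gap_ge_def)
  moreover have "gap_ge c (n - d) 0 \<inter> {\<nu> \<in> rr_partitions c (n - d). length \<nu> < 2} = {}"
    by (auto simp: gap_ge_def)
  ultimately have "card (rr_partitions c (n - d)) = card (gap_ge c (n - d) 0) + card {\<nu> \<in> rr_partitions c (n - d). length \<nu> < 2}"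
    using card_Un_disjoint[of "gap_ge c (n - d) 0" "{\<nu> \<in> rr_partitions c (n - d). length \<nu> < 2}"] by simp
  then show ?thesis unfolding g short using True by auto
next
  case False
  have "gap_ge c n d = {}"
  proof -
    have False if "\<nu> \<in> gap_ge c n d" for \<nu>
      using that False by (cases \<nu> rule: remdups_adj.cases) (auto simp: gap_ge_def rr_partitions_def is_partition_Cons)
    then show ?thesis by blast
  qed
  then show ?thesis using False by simp
qed

lemma div_eq_iff_between:
  fixes a M k :: int
  assumes "M > 0"
  shows "a div M = k \<longleftrightarrow> k * M \<le> a \<and> a < (k + 1) * M"
proof
  assume "a div M = k"
  then have "a = M * k + a mod M" using mult_div_mod_eq[of M a] by simp
  moreover have "0 \<le> a mod M" "a mod M < M" using assms by simp_all
  ultimately show "k * M \<le> a \<and> a < (k + 1) * M" by (simp add: algebra_simps)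
next
  assume "k * M \<le> a \<and> a < (k + 1) * M"
  then show "a div M = k"
    by (intro int_div_pos_eq[of _ _ _ "a - M * k"]) (simp_all add: algebra_simps)
qed

text \<open>
  The quotient by M is k exactly if the gap is at least kM but not at least (k + 1)M. The
  one-part partition of n is counted if Q holds and its part is admissible.
\<close>

lemma card_by_gap:
  assumes M: "M \<ge> 1" and n: "n \<ge> 1"
  shows "card {\<nu> \<in> rr_partitions c n. (length \<nu> = 1 \<longrightarrow> Q) \<and>
            (length \<nu> \<ge> 2 \<longrightarrow> (int (\<nu> ! 0) - int (\<nu> ! 1) - 2) div int M = int k)} + card (gap_ge c n (Suc k * M))
     = card (gap_ge c n (k * M)) + of_bool (c < n \<and> Q)" (is "card ?V + _ = _")
proof -
  have gapD: "(int (\<nu> ! 0) - int (\<nu> ! 1) - 2) div int M = int k \<longleftrightarrow>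
      \<nu> ! 1 + 2 + k * M \<le> \<nu> ! 0 \<and> \<not> \<nu> ! 1 + 2 + Suc k * M \<le> \<nu> ! 0" for \<nu> :: "nat list"
  proof -
    have "(int (\<nu> ! 0) - int (\<nu> ! 1) - 2) div int M = int k \<longleftrightarrow>
      int k * int M \<le> int (\<nu> ! 0) - int (\<nu> ! 1) - 2 \<and> int (\<nu> ! 0) - int (\<nu> ! 1) - 2 < (int k + 1) * int M"
      by (rule div_eq_iff_between) (use M in simp)
    also have "\<dots> \<longleftrightarrow> int (\<nu> ! 1 + 2 + k * M) \<le> int (\<nu> ! 0) \<and> \<not> int (\<nu> ! 1 + 2 + Suc k * M) \<le> int (\<nu> ! 0)"
      by (auto simp: algebra_simps)
    finally show ?thesis by (simp only: of_nat_le_iff)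
  qed
  let ?S = "if c < n \<and> Q then {[n]} else {}"
  have "\<nu> \<in> ?V \<union> gap_ge c n (Suc k * M) \<longleftrightarrow> \<nu> \<in> gap_ge c n (k * M) \<union> ?S" for \<nu>
    unfolding gapD using n
    by (cases \<nu> rule: remdups_adj.cases) (auto simp: gap_ge_def rr_partitions_def is_partition_Cons)
  then have "?V \<union> gap_ge c n (Suc k * M) = gap_ge c n (k * M) \<union> ?S" by blast
  moreover have "?V \<inter> gap_ge c n (Suc k * M) = {}" "gap_ge c n (k * M) \<inter> ?S = {}"
    unfolding gapD by (auto simp: gap_ge_def)
  moreover have "finite ?V" "finite (gap_ge c n d)" for d by (simp_all add: gap_ge_def)
  ultimately show ?thesis
    by (subst card_Un_disjoint[symmetric]) (simp_all add: card_Un_disjoint)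
qed

text \<open>
  Both counts are differences between the values at kM and at (k + 1)M of two functions that agree up
  to the contribution of the partitions with at most one part. The hypothesis on Q says that the
  one-part partition of n balances this contribution.
\<close>

lemma E_count_eq_card:
  assumes c: "c \<le> 1" and M: "M \<ge> 1" and n: "n \<ge> 1" and lam: "lam \<in> partitions_into (rr_set c) M"
    and Q: "of_bool (c < n \<and> Q) + of_bool (Suc k * M \<le> n \<and> (n = Suc k * M \<or> c < n - Suc k * M))
       = (of_bool (k * M \<le> n \<and> (n = k * M \<or> c < n - k * M)) :: nat)"
  shows "E_count (rr_set c) lam n k = card {\<nu> \<in> rr_partitions c n. (length \<nu> = 1 \<longrightarrow> Q) \<and>
            (length \<nu> \<ge> 2 \<longrightarrow> (int (\<nu> ! 0) - int (\<nu> ! 1) - 2) div int M = int k)}"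
  using E_count_eq[OF lam M, of n k] card_by_gap[OF M n, of c Q k]
    card_gap_ge[OF c, of n "k * M"] card_gap_ge[OF c, of n "Suc k * M"] Q
  unfolding rogers_ramanujan[OF c] by linarith

theorem corollary6p8:
  fixes M n k :: nat
  assumes "M \<ge> 1" and "n \<ge> 1"
  shows "(\<forall>lam \<in> partitions_into set_A M.
            E_count set_A lam n k =
              card {\<nu>. is_partition n \<nu> \<and> difference_ge2 \<nu> \<and>
                (length \<nu> = 1 \<longrightarrow> n div M = k) \<and>
                (length \<nu> \<ge> 2 \<longrightarrow> (int (\<nu> ! 0) - int (\<nu> ! 1) - 2) div int M = int k)}) \<and>
         (\<forall>lam \<in> partitions_into set_B M.
            E_count set_B lam n k =
              card {\<nu>. is_partition n \<nu> \<and> difference_ge2 \<nu> \<and> 1 \<notin> set \<nu> \<and>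
                (length \<nu> = 1 \<longrightarrow>
                  (\<exists>j::int. int n = int M * int k + j \<and>
                     ((2 \<le> j \<and> j \<le> int M - 1) \<or> j = 0 \<or> j = int M + 1))) \<and>
                (length \<nu> \<ge> 2 \<longrightarrow> (int (\<nu> ! 0) - int (\<nu> ! 1) - 2) div int M = int k)})"
proof (intro conjI ballI)
  have A: "set_A = rr_set 0" by (auto simp: set_A_def rr_set_def)
  have B: "set_B = rr_set 1" by (auto simp: set_B_def rr_set_def)
  fix lam
  {
    assume lam: "lam \<in> partitions_into set_A M"
    have "n div M = k \<longleftrightarrow> k * M \<le> n \<and> \<not> Suc k * M \<le> n"
    proof -
      have "n div M = k \<longleftrightarrow> int n div int M = int k" by (simp flip: zdiv_int)
      also have "\<dots> \<longleftrightarrow> int k * int M \<le> int n \<and> int n < (int k + 1) * int M"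
        by (rule div_eq_iff_between) (use assms in simp)
      also have "\<dots> \<longleftrightarrow> int (k * M) \<le> int n \<and> \<not> int (Suc k * M) \<le> int n"
        by (auto simp: algebra_simps)
      finally show ?thesis by (simp only: of_nat_le_iff)
    qed
    then have Q: "of_bool (0 < n \<and> n div M = k) + of_bool (Suc k * M \<le> n \<and> (n = Suc k * M \<or> 0 < n - Suc k * M))
       = (of_bool (k * M \<le> n \<and> (n = k * M \<or> 0 < n - k * M)) :: nat)"
      using assms by auto
    have R: "{\<nu>. is_partition n \<nu> \<and> difference_ge2 \<nu> \<and>
                (length \<nu> = 1 \<longrightarrow> n div M = k) \<and>
                (length \<nu> \<ge> 2 \<longrightarrow> (int (\<nu> ! 0) - int (\<nu> ! 1) - 2) div int M = int k)} =
      {\<nu> \<in> rr_partitions 0 n. (length \<nu> = 1 \<longrightarrow> n div M = k) \<and>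
            (length \<nu> \<ge> 2 \<longrightarrow> (int (\<nu> ! 0) - int (\<nu> ! 1) - 2) div int M = int k)}"
      unfolding rr_partitions_def is_partition_def by force
    show "E_count set_A lam n k =
              card {\<nu>. is_partition n \<nu> \<and> difference_ge2 \<nu> \<and>
                (length \<nu> = 1 \<longrightarrow> n div M = k) \<and>
                (length \<nu> \<ge> 2 \<longrightarrow> (int (\<nu> ! 0) - int (\<nu> ! 1) - 2) div int M = int k)}"
      unfolding R A by (rule E_count_eq_card) (use assms lam Q A in auto)
  next
    assume lam: "lam \<in> partitions_into set_B M"
    let ?Q = "\<exists>j::int. int n = int M * int k + j \<and>
                     ((2 \<le> j \<and> j \<le> int M - 1) \<or> j = 0 \<or> j = int M + 1)"
    \<comment> \<open>For \<open>M = 1\<close> the balance below would fail at \<open>n = k + 1\<close>, but 1 is not a sum of elements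
      of \<open>set_B\<close>.\<close>
    have M2: "M \<ge> 2"
    proof (cases lam)
      case Nil
      then show ?thesis using lam assms by (simp add: partitions_into_def)
    next
      case (Cons a as)
      then have "a \<in> set_B" "a \<le> M"
        using lam by (auto simp: partitions_into_def is_partition_Cons)
      moreover from this have "a \<noteq> 1" "a > 0" by (auto simp: set_B_def)
      ultimately show ?thesis by linarith
    qed
    have "int n = int M * int k + j \<longleftrightarrow> j = int n - int (k * M)" for j
      by (auto simp: algebra_simps)
    then have "?Q \<longleftrightarrow> (2 \<le> int n - int (k * M) \<and> int n - int (k * M) \<le> int M - 1)
        \<or> int n - int (k * M) = 0 \<or> int n - int (k * M) = int M + 1"
      by simp
    also have "\<dots> \<longleftrightarrow> (k * M + 2 \<le> n \<and> n + 1 \<le> k * M + M) \<or> n = k * M \<or> n = k * M + M + 1"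
      by linarith
    finally have q: "?Q \<longleftrightarrow> (k * M + 2 \<le> n \<and> n + 1 \<le> k * M + M) \<or> n = k * M \<or> n = k * M + M + 1" .
    have km: "k * M = 0 \<or> k * M \<ge> 2" using M2 by (cases k) auto
    \<comment> \<open>Write \<open>n = k * M + j\<close>. The partitions with at most one part that arise at kM and at (k + 1)M are the
      partitions of j and of j - M into at most one part, and the part 1 is excluded. Their numbers
      differ exactly for j = 0, for j from 2 to M - 1, and for j = M + 1, where j - M = 1.\<close>
    have Q: "of_bool (1 < n \<and> ?Q) + of_bool (Suc k * M \<le> n \<and> (n = Suc k * M \<or> 1 < n - Suc k * M))
       = (of_bool (k * M \<le> n \<and> (n = k * M \<or> 1 < n - k * M)) :: nat)"
      unfolding q mult_Suc using M2 km assms by (auto simp: of_bool_def)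
    have R: "{\<nu>. is_partition n \<nu> \<and> difference_ge2 \<nu> \<and> 1 \<notin> set \<nu> \<and> (length \<nu> = 1 \<longrightarrow> ?Q) \<and>
                (length \<nu> \<ge> 2 \<longrightarrow> (int (\<nu> ! 0) - int (\<nu> ! 1) - 2) div int M = int k)} =
      {\<nu> \<in> rr_partitions 1 n. (length \<nu> = 1 \<longrightarrow> ?Q) \<and>
            (length \<nu> \<ge> 2 \<longrightarrow> (int (\<nu> ! 0) - int (\<nu> ! 1) - 2) div int M = int k)}"
    proof -
      have "1 \<notin> set \<nu> \<longleftrightarrow> (\<forall>a\<in>set \<nu>. 1 < a)" if "is_partition n \<nu>" for \<nu>
        using that by (auto simp: is_partition_def) (metis Suc_lessI less_eq_Suc_le)
      then show ?thesis unfolding rr_partitions_def by blast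
    qed
    show "E_count set_B lam n k =
              card {\<nu>. is_partition n \<nu> \<and> difference_ge2 \<nu> \<and> 1 \<notin> set \<nu> \<and>
                (length \<nu> = 1 \<longrightarrow> ?Q) \<and>
                (length \<nu> \<ge> 2 \<longrightarrow> (int (\<nu> ! 0) - int (\<nu> ! 1) - 2) div int M = int k)}"
      unfolding R B by (rule E_count_eq_card) (use assms lam Q B in auto)
  }
qed

end
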